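(* For every integer $n \geq 2$, the space of orderings $\mathcal{O}(F_n)$ of the free group $F_n$ on $n$ generators is homeomorphic to the Cantor set.
   Context: An ordering on a group $\Gamma$ is a total order relation $\preceq$ on $\Gamma$ that is left-invariant ($g \preceq h$ implies $fg \preceq fh$ for all $f,g,h \in \Gamma$). $\mathcal{O}(\Gamma)$ denotes the set of all orderings on $\Gamma$, endowed with the topology having as sub-basis the sets $U_{f,g} = \{\preceq \,:\, f \prec g\}$, $f,g \in \Gamma$, $f\neq g$. *)

theory Defs
  imports "HOL-Analysis.Analysis" "HOL-Algebra.Group"
begin

section \<open>Free groups\<close>

text \<open>
  The letter \<open>(s, True)\<close> stands for the generator \<open>s\<close> and \<open>(s, False)\<close> for its inverse.
\<close>

type_synonym 'a letter = "'a \<times> bool"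

definition inv_letter :: "'a letter \<Rightarrow> 'a letter" where
  "inv_letter x = (fst x, \<not> snd x)"

definition reduced_word :: "'a letter list \<Rightarrow> bool" where
  "reduced_word w \<longleftrightarrow> successively (\<lambda>x y. y \<noteq> inv_letter x) w"

text \<open>\<open>push x w\<close> is the reduced form of \<open>x # w\<close>, for reduced \<open>w\<close>.\<close>

fun push :: "'a letter \<Rightarrow> 'a letter list \<Rightarrow> 'a letter list" where
  "push x [] = [x]"
| "push x (y # w) = (if y = inv_letter x then w else x # y # w)"

definition free_group :: "'a set \<Rightarrow> 'a letter list monoid" where
  "free_group S =
    \<lparr>carrier = {w. reduced_word w \<and> fst ` set w \<subseteq> S}, mult = (\<lambda>u v. foldr push u v), one = []\<rparr>"

lemma inv_letter_inv_letter [simp]: "inv_letter (inv_letter x) = x"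
  by (simp add: inv_letter_def)

lemma inv_letter_neq [simp]: "inv_letter x \<noteq> x" "x \<noteq> inv_letter x"
  by (auto simp: inv_letter_def prod_eq_iff)

lemma fst_inv_letter [simp]: "fst (inv_letter x) = fst x"
  by (simp add: inv_letter_def)

lemma reduced_word_Nil [simp]: "reduced_word []"
  by (simp add: reduced_word_def)

lemma reduced_word_single [simp]: "reduced_word [x]"
  by (simp add: reduced_word_def)

lemma reduced_word_Cons: "reduced_word (x # w) \<longleftrightarrow> reduced_word w \<and> (w = [] \<or> hd w \<noteq> inv_letter x)"
  by (cases w) (auto simp: reduced_word_def)

lemma reduced_word_push: "reduced_word w \<Longrightarrow> reduced_word (push x w)"
  by (cases w) (auto simp: reduced_word_Cons)

lemma push_reduced: "reduced_word (x # w) \<Longrightarrow> push x w = x # w"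
  by (cases w) (auto simp: reduced_word_Cons)

lemma push_inv_push: "reduced_word w \<Longrightarrow> push (inv_letter x) (push x w) = w"
  by (cases w) (auto simp: reduced_word_Cons push_reduced)

lemma push_push_inv: "reduced_word w \<Longrightarrow> push x (push (inv_letter x) w) = w"
  using push_inv_push[of w "inv_letter x"] by simp

lemma set_push: "set (push x w) \<subseteq> insert x (set w)"
  by (cases w) auto

lemma reduced_word_foldr_push: "reduced_word v \<Longrightarrow> reduced_word (foldr push u v)"
  by (induction u) (auto simp: reduced_word_push)

lemma set_foldr_push: "set (foldr push u v) \<subseteq> set u \<union> set v"
proof (induction u)
  case (Cons x u)
  then show ?case using set_push[of x "foldr push u v"] by auto
qed simp

lemma foldr_push_push:
  assumes "reduced_word w"
  shows "foldr push (push x u) w = push x (foldr push u w)"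
proof (cases u)
  case (Cons y u')
  show ?thesis
  proof (cases "y = inv_letter x")
    case True
    then show ?thesis using Cons push_push_inv[OF reduced_word_foldr_push[OF assms, of u'], of x] by simp
  qed (simp add: Cons)
qed simp

lemma foldr_push_assoc:
  "reduced_word w \<Longrightarrow> foldr push (foldr push u v) w = foldr push u (foldr push v w)"
  by (induction u) (auto simp: foldr_push_push)

lemma foldr_push_Nil: "reduced_word u \<Longrightarrow> foldr push u [] = u"
  by (induction u) (auto simp: reduced_word_Cons push_reduced)

lemma foldr_push_append_inverse:
  "reduced_word v \<Longrightarrow> foldr push (rev (map inv_letter u)) (foldr push u v) = v"
  by (induction u) (auto simp: push_inv_push reduced_word_foldr_push)

lemma foldr_push_closed:
  assumes "fst ` set u \<subseteq> S" "reduced_word v" "fst ` set v \<subseteq> S"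
  shows "foldr push u v \<in> carrier (free_group S)"
proof -
  have "fst ` set (foldr push u v) \<subseteq> fst ` (set u \<union> set v)"
    by (rule image_mono[OF set_foldr_push])
  also have "\<dots> \<subseteq> S"
    using assms by (simp add: image_Un)
  finally show ?thesis using assms reduced_word_foldr_push[of v u] by (simp add: free_group_def)
qed

theorem group_free_group: "group (free_group S)"
proof (rule groupI)
  fix x y assume "x \<in> carrier (free_group S)" "y \<in> carrier (free_group S)"
  then show "x \<otimes>\<^bsub>free_group S\<^esub> y \<in> carrier (free_group S)"
    using foldr_push_closed[of x S y] by (simp add: free_group_def)
next
  fix x assume x: "x \<in> carrier (free_group S)"
  let ?y = "foldr push (rev (map inv_letter x)) []"
  have "?y \<in> carrier (free_group S)"
    using x by (intro foldr_push_closed) (auto simp: free_group_def)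
  moreover have "?y \<otimes>\<^bsub>free_group S\<^esub> x = \<one>\<^bsub>free_group S\<^esub>"
    using x foldr_push_append_inverse[of "[]" x] foldr_push_assoc[of x _ "[]"]
    by (simp add: free_group_def foldr_push_Nil)
  ultimately show "\<exists>y\<in>carrier (free_group S). y \<otimes>\<^bsub>free_group S\<^esub> x = \<one>\<^bsub>free_group S\<^esub>"
    by blast
qed (auto simp: free_group_def foldr_push_assoc)

definition letter_eval :: "('b, 'c) monoid_scheme \<Rightarrow> ('a \<Rightarrow> 'b) \<Rightarrow> 'a letter \<Rightarrow> 'b" where
  "letter_eval H f x = (if snd x then f (fst x) else inv\<^bsub>H\<^esub> f (fst x))"

definition word_eval :: "('b, 'c) monoid_scheme \<Rightarrow> ('a \<Rightarrow> 'b) \<Rightarrow> 'a letter list \<Rightarrow> 'b" where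
  "word_eval H f w = foldr (\<lambda>x g. letter_eval H f x \<otimes>\<^bsub>H\<^esub> g) w \<one>\<^bsub>H\<^esub>"

theorem free_group_universal:
  assumes H: "group H" and f: "f \<in> S \<rightarrow> carrier H"
  shows "\<exists>h \<in> hom (free_group S) H. \<forall>s\<in>S. h [(s, True)] = f s" (is ?ex)
    and "\<lbrakk>h \<in> hom (free_group S) H; k \<in> hom (free_group S) H;
          \<forall>s\<in>S. h [(s, True)] = k [(s, True)]; w \<in> carrier (free_group S)\<rbrakk> \<Longrightarrow> h w = k w"
proof -
  interpret H: group H by fact
  let ?l = "letter_eval H f" and ?e = "word_eval H f"
  have lc: "?l x \<in> carrier H" if "fst x \<in> S" for x
    using that f by (auto simp: letter_eval_def)
  have ec: "?e w \<in> carrier H" if "fst ` set w \<subseteq> S" for w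
    using that by (induction w) (auto simp: word_eval_def lc)
  have eC: "?e (x # w) = ?l x \<otimes>\<^bsub>H\<^esub> ?e w" for x w
    by (simp add: word_eval_def)
  have li: "?l (inv_letter x) = inv\<^bsub>H\<^esub> ?l x" if "fst x \<in> S" for x
    using H.inv_inv[OF funcset_mem[OF f that]] by (simp add: letter_eval_def inv_letter_def)
  have ep: "?e (push x w) = ?l x \<otimes>\<^bsub>H\<^esub> ?e w" if "fst x \<in> S" "fst ` set w \<subseteq> S" for x w
  proof (cases w)
    case (Cons y v)
    show ?thesis
    proof (cases "y = inv_letter x")
      case True
      have "?l x \<otimes>\<^bsub>H\<^esub> (inv\<^bsub>H\<^esub> ?l x \<otimes>\<^bsub>H\<^esub> ?e v) = ?e v"
        using that Cons lc ec[of v] by (simp add: H.m_assoc[symmetric])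
      then show ?thesis using Cons True that by (simp add: eC li)
    qed (simp add: Cons eC)
  qed (simp add: word_eval_def)
  have em: "?e (foldr push u v) = ?e u \<otimes>\<^bsub>H\<^esub> ?e v"
    if "fst ` set u \<subseteq> S" "fst ` set v \<subseteq> S" for u v
    using that(1)
  proof (induction u)
    case Nil
    then show ?case using ec that(2) by (simp add: word_eval_def)
  next
    case (Cons x u)
    have "fst ` set (foldr push u v) \<subseteq> S"
      using set_foldr_push[of u v] Cons.prems that(2) by (auto dest!: subsetD)
    then show ?case using Cons that(2) lc ec by (simp add: ep eC H.m_assoc)
  qed
  have "?e \<in> hom (free_group S) H"
    by (auto simp: hom_def free_group_def ec em)
  moreover have "\<forall>s\<in>S. ?e [(s, True)] = f s"
    using funcset_mem[OF f] by (simp add: word_eval_def letter_eval_def)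
  ultimately show ?ex by blast
next
  assume h: "h \<in> hom (free_group S) H" and k: "k \<in> hom (free_group S) H"
    and hk: "\<forall>s\<in>S. h [(s, True)] = k [(s, True)]" and w: "w \<in> carrier (free_group S)"
  interpret F: group "free_group S" by (rule group_free_group)
  interpret h: group_hom "free_group S" H h
    by (simp add: group_hom_def group_hom_axioms_def F.group_axioms H h)
  interpret k: group_hom "free_group S" H k
    by (simp add: group_hom_def group_hom_axioms_def F.group_axioms H k)
  have gen: "[x] \<in> carrier (free_group S)" if "fst x \<in> S" for x
    using that by (simp add: free_group_def)
  have inv: "inv\<^bsub>free_group S\<^esub> [(s, True)] = [(s, False)]" if "s \<in> S" for s
    using that gen by (intro F.inv_equality) (auto simp: free_group_def inv_letter_def)
  have letter: "h [x] = k [x]" if "fst x \<in> S" for x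
  proof (cases "snd x")
    case True
    then show ?thesis using hk that by (metis prod.collapse)
  next
    case False
    then have x: "[x] = inv\<^bsub>free_group S\<^esub> [(fst x, True)]"
      using inv[OF that] by (metis prod.collapse)
    show ?thesis unfolding x using hk that gen by simp
  qed
  show "h w = k w" using w
  proof (induction w)
    case Nil
    then show ?case using h.hom_one k.hom_one by (simp add: free_group_def)
  next
    case (Cons x w)
    have x: "fst x \<in> S" and w: "w \<in> carrier (free_group S)"
      using Cons.prems by (auto simp: free_group_def reduced_word_Cons)
    have "x # w = [x] \<otimes>\<^bsub>free_group S\<^esub> w"
      using Cons.prems by (simp add: free_group_def push_reduced)
    then show ?case using x w gen letter Cons.IH by simp
  qed
qed


section \<open>Spaces of orderings\<close>

definition left_orderings :: "('a, 'b) monoid_scheme \<Rightarrow> ('a \<times> 'a) set set" where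
  "left_orderings G =
    {r. linear_order_on (carrier G) r \<and>
        (\<forall>f\<in>carrier G. \<forall>g\<in>carrier G. \<forall>h\<in>carrier G.
          (g, h) \<in> r \<longrightarrow> (f \<otimes>\<^bsub>G\<^esub> g, f \<otimes>\<^bsub>G\<^esub> h) \<in> r)}"

definition ordering_subbasic :: "('a, 'b) monoid_scheme \<Rightarrow> 'a \<Rightarrow> 'a \<Rightarrow> ('a \<times> 'a) set set" where
  "ordering_subbasic G f g = {r \<in> left_orderings G. (f, g) \<in> r \<and> f \<noteq> g}"

text \<open>
  The library's \<open>topology_generated_by\<close> takes the union of the given sets as its underlying space.
  Adding \<open>left_orderings G\<close> makes that union right for the trivial group as well.
\<close>

definition ordering_space :: "('a, 'b) monoid_scheme \<Rightarrow> ('a \<times> 'a) set topology" where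
  "ordering_space G =
    topology_generated_by
      (insert (left_orderings G)
        {ordering_subbasic G f g | f g. f \<in> carrier G \<and> g \<in> carrier G \<and> f \<noteq> g})"

lemma topspace_ordering_space [simp]: "topspace (ordering_space G) = left_orderings G"
  by (auto simp: ordering_space_def ordering_subbasic_def)


section \<open>The Cantor set\<close>

fun cantor_stage :: "nat \<Rightarrow> real set" where
  "cantor_stage 0 = {0..1}"
| "cantor_stage (Suc k) =
    (\<lambda>x. x / 3) ` cantor_stage k \<union> (\<lambda>x. 2 / 3 + x / 3) ` cantor_stage k"

definition cantor_set :: "real set" where
  "cantor_set = (\<Inter>k. cantor_stage k)"

end

theory Submission
  imports Defs "HOL-Library.Fun_Lexorder"
begin

text \<open>
  The space of orderings is a compact, zero-dimensional, second countable space, so by Brouwer's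
  theorem it is a Cantor set as soon as it is nonempty and has no isolated point. Brouwer's theorem
  is proved by cutting the space repeatedly along the first set of a separating clopen sequence that
  splits the current piece; the choices made are the ternary digits of the image point.

  Both remaining claims come from actions on the real line. Since the generators are free, each of
  them may be any increasing bijection of the line, in particular any extension of a finite
  increasing partial map. For nonemptiness, every nontrivial reduced word moves a point in some
  action, and the orbits of that point in countably many such actions are compared
  lexicographically. For the absence of isolated points, the ordering restricted to a ball is realised
  by the orbit of a point under an action; the image of the largest element of the ball under a
  suitable generator is not determined by the ball and can be put on either side of this element.
  The order of the orbit, with ties broken by the given ordering, is an ordering that agrees with the
  given one on the ball.
\<close>

section \<open>Ternary expansions\<close>

text \<open>Digits 0 and 2 only: the usual coding of the middle-thirds set by binary
  sequences.\<close>

definition ternary :: "(nat \<Rightarrow> bool) \<Rightarrow> real" where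
  "ternary b = (\<Sum>i. 2 * of_bool (b i) / 3 ^ Suc i)"

lemma ternary_terms_le: "2 * of_bool (b i) / 3 ^ Suc i \<le> (2 / 3 * (1 / 3) ^ i :: real)"
  by (simp add: power_one_over field_simps)

lemma summable_ternary: "summable (\<lambda>i. 2 * of_bool (b i) / 3 ^ Suc i :: real)"
proof (rule summable_comparison_test')
  show "summable (\<lambda>i. 2 / 3 * (1 / 3) ^ i :: real)"
    by (intro summable_mult summable_geometric) simp
  show "norm (2 * of_bool (b i) / 3 ^ Suc i :: real) \<le> 2 / 3 * (1 / 3) ^ i" for i
    using ternary_terms_le[of b i] by simp
qed

lemma ternary_nonneg: "0 \<le> ternary b"
  unfolding ternary_def by (intro suminf_nonneg summable_ternary) auto

lemma ternary_le_1: "ternary b \<le> 1"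
proof -
  have "(\<lambda>i. 2 / 3 * (1 / 3) ^ i) sums (2 / 3 * (1 / (1 - 1 / 3 :: real)))"
    by (intro sums_mult geometric_sums) simp
  then have *: "summable (\<lambda>i. 2 / 3 * (1 / 3) ^ i :: real)" "(\<Sum>i. 2 / 3 * (1 / 3) ^ i :: real) = 1"
    by (auto simp: sums_iff)
  have "ternary b \<le> (\<Sum>i. 2 / 3 * (1 / 3) ^ i)"
    unfolding ternary_def by (intro suminf_le ternary_terms_le summable_ternary *(1))
  then show ?thesis by (simp only: *(2))
qed

lemma ternary_rec: "ternary b = (2 * of_bool (b 0) + ternary (b \<circ> Suc)) / 3"
proof -
  have "ternary b = (\<Sum>i. 2 * of_bool (b (Suc i)) / 3 ^ Suc (Suc i)) + 2 * of_bool (b 0) / 3 ^ Suc 0"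
    unfolding ternary_def using suminf_split_head[OF summable_ternary, of b] by simp
  also have "(\<Sum>i. 2 * of_bool (b (Suc i)) / 3 ^ Suc (Suc i) :: real) = ternary (b \<circ> Suc) / 3"
    unfolding ternary_def
    by (subst suminf_divide[OF summable_ternary, symmetric]) (simp add: field_simps)
  finally show ?thesis by simp
qed

text \<open>A leading digit 0 keeps the value at or below 1/3 and a leading digit 2 at or above 2/3,
  so the value determines the first digit; induction passes to the shifted sequence.\<close>

lemma ternary_inj:
  assumes "ternary b = ternary c"
  shows "b i = c i"
  using assms
proof (induction i arbitrary: b c)
  case 0
  then show ?case
    using ternary_rec[of b] ternary_rec[of c] ternary_nonneg[of "b \<circ> Suc"]
      ternary_nonneg[of "c \<circ> Suc"] ternary_le_1[of "b \<circ> Suc"] ternary_le_1[of "c \<circ> Suc"]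
    by (auto simp: of_bool_def split: if_splits)
next
  case (Suc i)
  have "b 0 = c 0"
    using Suc.prems ternary_rec[of b] ternary_rec[of c] ternary_nonneg[of "b \<circ> Suc"]
      ternary_nonneg[of "c \<circ> Suc"] ternary_le_1[of "b \<circ> Suc"] ternary_le_1[of "c \<circ> Suc"]
    by (auto simp: of_bool_def split: if_splits)
  then have "ternary (b \<circ> Suc) = ternary (c \<circ> Suc)"
    using Suc.prems ternary_rec[of b] ternary_rec[of c] by simp
  from Suc.IH[OF this] show ?case by simp
qed

text \<open>By \<open>ternary_rec\<close> each common leading digit divides the difference by 3,
  starting from values in the unit interval. The estimate later gives continuity of the digit
  map.\<close>

lemma ternary_close:
  assumes "\<And>i. i < n \<Longrightarrow> b i = c i"
  shows "\<bar>ternary b - ternary c\<bar> \<le> (1 / 3) ^ n"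
  using assms
proof (induction n arbitrary: b c)
  case 0
  then show ?case
    using ternary_nonneg[of b] ternary_nonneg[of c] ternary_le_1[of b] ternary_le_1[of c]
    by simp
next
  case (Suc n)
  have "ternary b - ternary c = (ternary (b \<circ> Suc) - ternary (c \<circ> Suc)) / 3"
    using Suc.prems[of 0] ternary_rec[of b] ternary_rec[of c] by (simp add: field_simps)
  moreover have "\<bar>ternary (b \<circ> Suc) - ternary (c \<circ> Suc)\<bar> \<le> (1 / 3) ^ n"
    by (rule Suc.IH) (simp add: Suc.prems)
  ultimately show ?case by (simp add: abs_if split: if_splits)
qed

lemma ternary_in_cantor_stage: "ternary b \<in> cantor_stage k"
proof (induction k arbitrary: b)
  case 0
  show ?case using ternary_nonneg[of b] ternary_le_1[of b] by simp
next
  case (Suc k)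
  have "ternary b = (if b 0 then 2 / 3 + ternary (b \<circ> Suc) / 3 else ternary (b \<circ> Suc) / 3)"
    by (subst ternary_rec) (simp add: field_simps)
  then show ?case using Suc.IH[of "b \<circ> Suc"] by (auto simp del: o_apply)
qed

lemma cantor_stage_bounds: "x \<in> cantor_stage k \<Longrightarrow> 0 \<le> x \<and> x \<le> 1"
  by (induction k arbitrary: x) force+

text \<open>Deletes the first ternary digit of a point of the Cantor set. The threshold 1/2 lies in
  the removed middle third, so it tells the two halves apart.\<close>

definition cantor_shift :: "real \<Rightarrow> real" where
  "cantor_shift x = (if x > 1 / 2 then 3 * x - 2 else 3 * x)"

lemma cantor_shift_in_cantor_set:
  assumes "x \<in> cantor_set"
  shows "cantor_shift x \<in> cantor_set"
proof -
  have "cantor_shift x \<in> cantor_stage k" for k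
  proof -
    have "x \<in> cantor_stage (Suc k)" using assms unfolding cantor_set_def by blast
    then obtain y where "y \<in> cantor_stage k" "x = y / 3 \<or> x = 2 / 3 + y / 3" by auto
    then show ?thesis
      using cantor_stage_bounds[of y k] by (auto simp: cantor_shift_def mult.commute)
  qed
  then show ?thesis by (simp add: cantor_set_def)
qed

lemma range_ternary: "range ternary = cantor_set"
proof
  show "range ternary \<subseteq> cantor_set"
    using ternary_in_cantor_stage by (auto simp: cantor_set_def)
  show "cantor_set \<subseteq> range ternary"
  proof
    fix x assume x: "x \<in> cantor_set"
    \<comment> \<open>The itinerary of \<open>y\<close> under the shift serves as its digit
      sequence. The error at \<open>y\<close> is a third of the error at
      \<open>cantor_shift y\<close>, so it vanishes in the limit.\<close>
    define b where "b y i = ((cantor_shift ^^ i) y > 1 / 2)" for y i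
    have close: "\<bar>y - ternary (b y)\<bar> \<le> (1 / 3) ^ n" if "y \<in> cantor_set" for y n
      using that
    proof (induction n arbitrary: y)
      case 0
      then have "y \<in> cantor_stage 0" unfolding cantor_set_def by blast
      then show ?case
        using ternary_nonneg[of "b y"] ternary_le_1[of "b y"] by (simp add: abs_if split: if_splits)
    next
      case (Suc n)
      have "b y \<circ> Suc = b (cantor_shift y)" by (auto simp: b_def funpow_swap1)
      then have "y - ternary (b y) = (cantor_shift y - ternary (b (cantor_shift y))) / 3"
        by (subst ternary_rec) (simp add: b_def cantor_shift_def field_simps)
      then show ?case
        using Suc.IH[OF cantor_shift_in_cantor_set[OF Suc.prems]]
        by (simp add: abs_if split: if_splits)
    qed
    have "(\<lambda>n. (1 / 3 :: real) ^ n) \<longlonglongrightarrow> 0" by (rule LIMSEQ_realpow_zero) auto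
    then have "\<bar>x - ternary (b x)\<bar> \<le> 0"
      by (rule LIMSEQ_le_const) (use close[OF x] in auto)
    then show "x \<in> range ternary" by auto
  qed
qed

section \<open>Brouwer's characterisation of the Cantor set\<close>

text \<open>\<open>D i\<close> collects the points whose \<open>i\<close>-th digit is nonzero.
  Agreement in finitely many digits is an open condition, which gives continuity; compactness passes
  from finite patterns to infinite ones, which gives surjectivity; a continuous bijection from a
  compact space onto a Hausdorff space is a homeomorphism.\<close>

lemma homeomorphic_cantor_set_of_digits:
  fixes D :: "nat \<Rightarrow> 'a set"
  assumes X: "compact_space X"
    and clopen: "\<And>i. openin X (D i)" "\<And>i. closedin X (D i)"
    and separating: "\<And>x y. \<lbrakk>x \<in> topspace X; y \<in> topspace X; \<And>i. x \<in> D i \<longleftrightarrow> y \<in> D i\<rbrakk> \<Longrightarrow> x = y"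
    and patterns: "\<And>b n. \<exists>x\<in>topspace X. \<forall>i<n. x \<in> D i \<longleftrightarrow> b i"
  shows "X homeomorphic_space top_of_set cantor_set"
proof -
  define h where "h x = ternary (\<lambda>i. x \<in> D i)" for x
  define N where "N n x = {y \<in> topspace X. \<forall>i<n. y \<in> D i \<longleftrightarrow> x \<in> D i}" for n x
  have N: "openin X (N n x)" for n x
  proof (induction n)
    case (Suc n)
    have "N (Suc n) x = N n x \<inter> (if x \<in> D n then D n else topspace X - D n)"
      by (auto simp: N_def less_Suc_eq)
    then show ?case using Suc clopen[of n] by (auto simp: closedin_def)
  qed (simp add: N_def)
  have "continuous_map X euclideanreal h"
    unfolding mtopology_is_euclidean[symmetric] Met_TC.continuous_map_to_metric
  proof (intro ballI allI impI)
    fix x and e :: real assume x: "x \<in> topspace X" and "e > 0"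
    then obtain n where n: "(1 / 3) ^ n < e"
      using real_arch_pow_inv[of e "1 / 3"] by auto
    have "h y \<in> Met_TC.mball (h x) e" if "y \<in> N n x" for y
      using ternary_close[of n "\<lambda>i. x \<in> D i" "\<lambda>i. y \<in> D i"] that n
      by (auto simp: N_def h_def dist_real_def)
    then show "\<exists>U. openin X U \<and> x \<in> U \<and> (\<forall>y\<in>U. h y \<in> Met_TC.mball (h x) e)"
      using N[of n x] x by (intro exI[of _ "N n x"]) (auto simp: N_def)
  qed
  moreover have "h ` topspace X = cantor_set"
  proof
    show "h ` topspace X \<subseteq> cantor_set" using range_ternary by (auto simp: h_def)
    show "cantor_set \<subseteq> h ` topspace X"
    proof
      fix t assume "t \<in> cantor_set"
      then obtain b where b: "t = ternary b" using range_ternary by blast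
      define C where "C n = {x \<in> topspace X. \<forall>i<n. x \<in> D i \<longleftrightarrow> b i}" for n
      have "closedin X (C n)" for n
      proof (induction n)
        case (Suc n)
        have "C (Suc n) = C n \<inter> (if b n then D n else topspace X - D n)"
          by (auto simp: C_def less_Suc_eq)
        then show ?case using Suc clopen by auto
      qed (simp add: C_def)
      moreover have "C n \<noteq> {}" for n using patterns[of n b] by (auto simp: C_def)
      moreover have "decseq C" by (auto simp: decseq_def C_def)
      ultimately have "(\<Inter>n. C n) \<noteq> {}" using X by (intro compact_space_imp_nest) auto
      then obtain x where x: "\<And>n. x \<in> C n" by blast
      have "(\<lambda>i. x \<in> D i) = b"
      proof
        show "(x \<in> D i) = b i" for i using x[of "Suc i"] by (auto simp: C_def)
      qed
      then show "t \<in> h ` topspace X" using x[of 0] b by (auto simp: C_def h_def)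
    qed
  qed
  moreover have "inj_on h (topspace X)"
    using separating ternary_inj unfolding inj_on_def h_def by blast
  ultimately have "homeomorphic_map X (top_of_set cantor_set) h"
    using X by (intro continuous_imp_homeomorphic_map)
      (auto simp: continuous_map_in_subtopology Hausdorff_space_subtopology)
  then show ?thesis by (rule homeomorphic_map_imp_homeomorphic_space)
qed

definition splits :: "'a set \<Rightarrow> 'a set \<Rightarrow> bool" where
  "splits A C \<longleftrightarrow> A \<inter> C \<noteq> {} \<and> A - C \<noteq> {}"

text \<open>With the sets \<open>C k\<close> themselves as digits, some digit patterns could be
  empty. Cutting each piece along the first \<open>C k\<close> that splits it keeps both halves
  nonempty, so all patterns occur.\<close>

theorem homeomorphic_cantor_set:
  fixes C :: "nat \<Rightarrow> 'a set"
  assumes X: "compact_space X" and ne: "topspace X \<noteq> {}"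
    and clopen: "\<And>k. openin X (C k)" "\<And>k. closedin X (C k)"
    and separating: "\<And>x y. \<lbrakk>x \<in> topspace X; y \<in> topspace X; \<And>k. x \<in> C k \<longleftrightarrow> y \<in> C k\<rbrakk> \<Longrightarrow> x = y"
    and perfect: "\<And>x. \<not> openin X {x}"
  shows "X homeomorphic_space top_of_set cantor_set"
proof -
  \<comment> \<open>\<open>cell x i\<close> is the piece around \<open>x\<close> after
    \<open>i\<close> cuts, and each cut depends on the piece alone. \<open>LEAST\<close> is
    meaningful only if some \<open>C k\<close> splits the piece, which
    \<open>splits_\<kappa>\<close> secures for nonempty open sets.\<close>
  define \<kappa> where "\<kappa> A = (LEAST k. splits A (C k))" for A
  define cell where "cell x = rec_nat (topspace X)
    (\<lambda>_ A. {y \<in> A. y \<in> C (\<kappa> A) \<longleftrightarrow> x \<in> C (\<kappa> A)})" for x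
  have cell_0: "cell x 0 = topspace X" for x by (simp add: cell_def)
  have cell_Suc: "cell x (Suc i) =
      {y \<in> cell x i. y \<in> C (\<kappa> (cell x i)) \<longleftrightarrow> x \<in> C (\<kappa> (cell x i))}" for x i
    by (simp add: cell_def)
  define D where "D i = {x \<in> topspace X. x \<in> C (\<kappa> (cell x i))}" for i
  have cell_self: "x \<in> cell x i" if "x \<in> topspace X" for x i
    using that by (induction i) (auto simp: cell_0 cell_Suc)
  have cell_sub: "cell x i \<subseteq> topspace X" for x i
    by (induction i) (auto simp: cell_0 cell_Suc)
  have cell_open: "openin X (cell x i)" for x i
  proof (induction i)
    case (Suc i)
    have "cell x (Suc i) = cell x i \<inter>
        (if x \<in> C (\<kappa> (cell x i)) then C (\<kappa> (cell x i)) else topspace X - C (\<kappa> (cell x i)))"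
      using cell_sub[of x i] by (auto simp: cell_Suc)
    then show ?case using Suc clopen(1)[of "\<kappa> (cell x i)"] clopen(2)[of "\<kappa> (cell x i)"]
      by (auto simp: closedin_def)
  qed (simp add: cell_0)
  have cell_eq: "cell y j = cell x j" if "y \<in> cell x i" "j \<le> i" for x y i j
    using that
  proof (induction i arbitrary: j)
    case (Suc i)
    then have *: "y \<in> cell x i" "cell y i = cell x i" by (auto simp: cell_Suc)
    show ?case
    proof (cases "j = Suc i")
      case True
      then show ?thesis using * Suc.prems(1) by (auto simp: cell_Suc)
    next
      case False
      then show ?thesis using Suc.IH[OF *(1)] Suc.prems(2) by simp
    qed
  qed (simp add: cell_0)
  \<comment> \<open>Without isolated points a nonempty open set has two points, and some
    \<open>C k\<close> separates them.\<close>
  have splits_\<kappa>: "splits A (C (\<kappa> A))" if A: "openin X A" "A \<noteq> {}" for A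
  proof -
    obtain x where x: "x \<in> A" using A by blast
    have "A \<noteq> {x}" using perfect[of x] A(1) by auto
    then obtain y where y: "y \<in> A" "y \<noteq> x" using x by blast
    have "x \<in> topspace X" "y \<in> topspace X" using x y openin_subset[OF A(1)] by auto
    with separating[of x y] y obtain k where "x \<in> C k \<longleftrightarrow> y \<notin> C k" by blast
    then have "splits A (C k)" using x y by (auto simp: splits_def)
    then show ?thesis unfolding \<kappa>_def by (rule LeastI)
  qed
  \<comment> \<open>Since the smallest splitting index comes first, \<open>C k\<close> is used at
    step \<open>k\<close> at the latest unless it no longer splits the piece. Hence the cells
    separate whatever the sets \<open>C k\<close> separate.\<close>
  have not_splits: "\<not> splits (cell x i) (C k)" if "k < i" for x i k
    using that
  proof (induction i arbitrary: k)
    case (Suc i)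
    show ?case
    proof (cases "k = \<kappa> (cell x i)")
      case True
      then show ?thesis by (auto simp: splits_def cell_Suc)
    next
      case False
      have "\<not> splits (cell x i) (C k)"
      proof
        assume *: "splits (cell x i) (C k)"
        then have "\<not> k < i" using Suc.IH by blast
        then have "k = i" using Suc.prems by simp
        have "\<kappa> (cell x i) \<le> k" unfolding \<kappa>_def using * by (rule Least_le)
        then have "\<kappa> (cell x i) < i" using False \<open>k = i\<close> by simp
        moreover have "splits (cell x i) (C (\<kappa> (cell x i)))"
          using * cell_open by (intro splits_\<kappa>) (auto simp: splits_def)
        ultimately show False using Suc.IH by blast
      qed
      then show ?thesis by (auto simp: splits_def cell_Suc)
    qed
  qed simp
  have D_cell: "y \<in> D i \<longleftrightarrow> x \<in> D i" if "x \<in> topspace X" "y \<in> cell x (Suc i)" for x y i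
    using that cell_eq[of y x "Suc i" i] cell_sub[of x "Suc i"] by (auto simp: D_def cell_Suc)
  show ?thesis
  proof (rule homeomorphic_cantor_set_of_digits[OF X, of D])
    fix i
    show "openin X (D i)"
    proof (subst openin_subopen, intro ballI)
      fix x assume x: "x \<in> D i"
      then have "x \<in> topspace X" by (simp add: D_def)
      then show "\<exists>T. openin X T \<and> x \<in> T \<and> T \<subseteq> D i"
        using x D_cell[of x _ i] cell_self cell_open by (intro exI[of _ "cell x (Suc i)"]) blast
    qed
    have "openin X (topspace X - D i)"
    proof (subst openin_subopen, intro ballI)
      fix x assume "x \<in> topspace X - D i"
      then show "\<exists>T. openin X T \<and> x \<in> T \<and> T \<subseteq> topspace X - D i"
        using D_cell[of x _ i] cell_self cell_open cell_sub
        by (intro exI[of _ "cell x (Suc i)"]) blast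
    qed
    then show "closedin X (D i)" by (auto simp: closedin_def D_def)
  next
    fix x y assume xy: "x \<in> topspace X" "y \<in> topspace X" "\<And>i. x \<in> D i \<longleftrightarrow> y \<in> D i"
    have same: "cell x i = cell y i" for i
    proof (induction i)
      case (Suc i)
      then show ?case using xy(3)[of i] xy(1,2) by (auto simp: cell_Suc D_def)
    qed (simp add: cell_0)
    show "x = y"
    proof (rule separating[OF xy(1,2)])
      fix k
      have "x \<in> cell x (Suc k)" "y \<in> cell x (Suc k)"
        using cell_self xy(1,2) same by auto
      then show "x \<in> C k \<longleftrightarrow> y \<in> C k"
        using not_splits[of k "Suc k" x] by (auto simp: splits_def)
    qed
  next
    fix b :: "nat \<Rightarrow> bool" and n
    show "\<exists>x\<in>topspace X. \<forall>i<n. x \<in> D i \<longleftrightarrow> b i"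
    proof (induction n)
      case 0
      show ?case using ne by (simp only: ex_in_conv[symmetric]) auto
    next
      case (Suc n)
      then obtain x where x: "x \<in> topspace X" "\<forall>i<n. x \<in> D i \<longleftrightarrow> b i" by blast
      have "splits (cell x n) (C (\<kappa> (cell x n)))"
        using cell_open cell_self[OF x(1)] by (intro splits_\<kappa>) auto
      \<comment> \<open>Taking \<open>y\<close> in the half prescribed by \<open>b n\<close> fixes
        the new digit; \<open>y\<close> shares the cells of \<open>x\<close> up to stage
        \<open>n\<close> and therefore the earlier digits.\<close>
      then obtain y where y: "y \<in> cell x n" "y \<in> C (\<kappa> (cell x n)) \<longleftrightarrow> b n"
        by (cases "b n") (auto simp: splits_def)
      have "y \<in> topspace X" using y cell_sub by blast
      moreover have "y \<in> D i \<longleftrightarrow> b i" if "i < Suc n" for i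
      proof (cases "i = n")
        case True
        then show ?thesis using y cell_eq[OF y(1), of n] \<open>y \<in> topspace X\<close> by (simp add: D_def)
      next
        case False
        then have "i < n" using that by simp
        then have "cell y (Suc i) = cell x (Suc i)" using cell_eq[OF y(1), of "Suc i"] by simp
        then have "y \<in> cell x (Suc i)" using cell_self[OF \<open>y \<in> topspace X\<close>] by blast
        then show ?thesis using D_cell[OF x(1)] x(2) \<open>i < n\<close> by blast
      qed
      ultimately show ?case by blast
    qed
  qed
qed

section \<open>Actions of the free group on the line\<close>

text \<open>Points are inserted from left to right. An extension \<open>f\<close> for the earlier
  points is followed by a map \<open>g\<close> that is the identity up to \<open>M\<close>, where
  the old values lie, and linear beyond \<open>M\<close> with the slope that carries
  \<open>f b\<close> to \<open>h b\<close>.\<close>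

lemma strict_mono_on_finite_extension:
  fixes h :: "real \<Rightarrow> real"
  assumes "finite A" "strict_mono_on A h"
  shows "\<exists>f. strict_mono f \<and> surj f \<and> (\<forall>x\<in>A. f x = h x)"
  using assms
proof (induction A rule: finite_linorder_max_induct)
  case empty
  show ?case by (intro exI[of _ id]) (auto simp: strict_mono_def)
next
  case (insert b A)
  have "strict_mono_on A h" using insert.prems by (auto simp: strict_mono_on_def)
  with insert.IH obtain f where f: "strict_mono f" "surj f" "\<forall>x\<in>A. f x = h x" by blast
  obtain M where M: "\<forall>x\<in>A. h x \<le> M" "M < h b" "M < f b"
  proof (cases "A = {}")
    case True
    then show ?thesis using that[of "min (h b) (f b) - 1"] by auto
  next
    case False
    let ?M = "Max (h ` A)"
    have "?M \<in> h ` A" using False insert.hyps by (intro Max_in) auto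
    then obtain a where a: "a \<in> A" "?M = h a" by auto
    then have "h a < h b" "f a < f b"
      using insert.hyps insert.prems f(1) by (auto simp: strict_mono_on_def strict_mono_def)
    moreover have "\<forall>x\<in>A. h x \<le> ?M" using insert.hyps by simp
    ultimately show ?thesis using that[of ?M] a f(3) by simp
  qed
  define s where "s = (h b - M) / (f b - M)"
  have s: "s > 0" using M by (simp add: s_def)
  define g where "g t = (if t \<le> M then t else M + (t - M) * s)" for t
  have "strict_mono g"
    unfolding strict_mono_def
  proof (intro allI impI)
    fix x y :: real assume "x < y"
    moreover have "x < y \<Longrightarrow> M < y \<Longrightarrow> x \<le> M \<Longrightarrow> x < M + (y - M) * s"
      using mult_pos_pos[of "y - M" s] s by linarith
    ultimately show "g x < g y" using s by (auto simp: g_def)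
  qed
  moreover have "surj g"
  proof (rule surjI)
    fix t show "g (if t \<le> M then t else M + (t - M) / s) = t"
      using s by (auto simp: g_def divide_le_0_iff)
  qed
  moreover have "g (f b) = h b" using M by (simp add: g_def s_def)
  moreover have "g (f x) = h x" if "x \<in> A" for x using that f(3) M by (simp add: g_def)
  ultimately show ?case
    using f comp_surj[OF f(2)] by (intro exI[of _ "g \<circ> f"]) (simp add: strict_mono_def comp_def)
qed

section \<open>Reduced words acting on the line\<close>

lemma push_cases: "push x w = x # w \<or> w = inv_letter x # push x w"
  by (cases w) auto

lemma length_push_le: "length (push x w) \<le> Suc (length w)"
  by (cases w) auto

lemma length_push_neq: "length (push x w) \<noteq> length w"
  by (cases w) auto

text \<open>As \<open>inv_letter\<close> is an involution, the second condition makes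
  \<open>\<phi> (inv_letter x)\<close> a two-sided inverse of \<open>\<phi> x\<close>. So
  \<open>foldr \<phi>\<close> is an action of the free group by increasing bijections.\<close>

definition line_action :: "('a letter \<Rightarrow> real \<Rightarrow> real) \<Rightarrow> bool" where
  "line_action \<phi> \<longleftrightarrow> (\<forall>x. strict_mono (\<phi> x)) \<and> (\<forall>x t. \<phi> (inv_letter x) (\<phi> x t) = t)"

text \<open>A cancellation in \<open>push\<close> is matched by the cancellation of
  \<open>\<phi> x\<close> against \<open>\<phi> (inv_letter x)\<close>.\<close>

lemma foldr_push_line_action:
  assumes "line_action \<phi>"
  shows "foldr \<phi> (foldr push u v) t = foldr \<phi> u (foldr \<phi> v t)"
proof (induction u)
  case (Cons x u)
  have "foldr \<phi> (push x w) t = \<phi> x (foldr \<phi> w t)" for w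
  proof (cases w)
    case (Cons y w')
    have "\<phi> x (\<phi> (inv_letter x) s) = s" for s
      using assms inv_letter_inv_letter[of x] unfolding line_action_def by metis
    then show ?thesis using Cons by simp
  qed simp
  then show ?case using Cons by simp
qed simp

lemma strict_mono_foldr: "line_action \<phi> \<Longrightarrow> strict_mono (foldr \<phi> w)"
  by (induction w) (auto simp: line_action_def strict_mono_def)

text \<open>The tree-like shape of the Cayley graph lets the generators be extended independently.\<close>

lemma line_action_extension:
  fixes B :: "'a letter list set" and e :: "'a letter list \<Rightarrow> real"
  assumes fin: "finite B" and red: "\<And>w. w \<in> B \<Longrightarrow> reduced_word w"
    and suffix: "\<And>x w. x # w \<in> B \<Longrightarrow> w \<in> B"
    and inj: "inj_on e B"
    and mono: "\<And>a u v. \<lbrakk>u \<in> B; v \<in> B; push (a, True) u \<in> B; push (a, True) v \<in> B; e u < e v\<rbrakk>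
      \<Longrightarrow> e (push (a, True) u) < e (push (a, True) v)"
  obtains \<phi> where "line_action \<phi>" "\<And>w. w \<in> B \<Longrightarrow> foldr \<phi> w (e []) = e w"
proof -
  have "\<exists>f. strict_mono f \<and> surj f \<and> (\<forall>u\<in>B. push (a, True) u \<in> B \<longrightarrow> f (e u) = e (push (a, True) u))" for a
  proof -
    \<comment> \<open>The constraints on the generator \<open>a\<close> form a finite partial map:
      well defined because \<open>e\<close> is injective, increasing by \<open>mono\<close>.\<close>
    let ?A = "e ` {u \<in> B. push (a, True) u \<in> B}"
    let ?h = "\<lambda>t. e (push (a, True) (inv_into B e t))"
    have "strict_mono_on ?A ?h"
      using mono inj by (auto simp: strict_mono_on_def inv_into_f_f)
    with fin obtain f where "strict_mono f" "surj f" "\<forall>t\<in>?A. f t = ?h t"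
      using strict_mono_on_finite_extension[of ?A ?h] by auto
    then show ?thesis using inj by (intro exI[of _ f]) (auto simp: inv_into_f_f)
  qed
  then obtain f where f: "\<And>a. strict_mono (f a)" "\<And>a. surj (f a)"
    "\<And>a u. \<lbrakk>u \<in> B; push (a, True) u \<in> B\<rbrakk> \<Longrightarrow> f a (e u) = e (push (a, True) u)"
    by metis
  define \<phi> where "\<phi> x = (if snd x then f (fst x) else inv_into UNIV (f (fst x)))" for x
  have injf: "inj (f a)" for a using f(1) by (simp add: strict_mono_imp_inj_on)
  have "strict_mono (inv_into UNIV (f a))" for a
    by (rule strict_mono_inv[OF f(1,2)]) (rule inv_f_f[OF injf])
  then have "line_action \<phi>"
    using f(1,2) injf by (auto simp: line_action_def \<phi>_def inv_letter_def surj_f_inv_f)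
  moreover have "foldr \<phi> w (e []) = e w" if "w \<in> B" for w
    using that
  proof (induction w)
    case (Cons x w)
    have w: "w \<in> B" using suffix Cons.prems by blast
    have push: "push x w = x # w" using red[OF Cons.prems] by (rule push_reduced)
    obtain a s where x: "x = (a, s)" by fastforce
    show ?case
    proof (cases s)
      case True
      then show ?thesis using Cons w push f(3)[of w a] by (simp add: x \<phi>_def)
    next
      case False
      \<comment> \<open>A negative letter uses the constraint on the positive generator, from
        \<open>x # w\<close> to \<open>w\<close>, read backwards.\<close>
      then have "push (a, True) (x # w) = w" by (simp add: x inv_letter_def)
      then have "f a (e (x # w)) = e w" using f(3)[of "x # w" a] Cons.prems w by simp
      then have "inv_into UNIV (f a) (e w) = e (x # w)" using injf by (metis inv_f_f)
      then show ?thesis using False Cons w by (simp add: x \<phi>_def)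
    qed
  qed simp
  ultimately show ?thesis using that by blast
qed

section \<open>Left orderings of the free group\<close>

lemma carrier_free_group: "w \<in> carrier (free_group S) \<longleftrightarrow> reduced_word w \<and> fst ` set w \<subseteq> S"
  by (simp add: free_group_def)

lemma mult_free_group: "u \<otimes>\<^bsub>free_group S\<^esub> v = foldr push u v"
  by (simp add: free_group_def)

lemma one_free_group: "\<one>\<^bsub>free_group S\<^esub> = []"
  by (simp add: free_group_def)

lemma Nil_in_free_group [simp]: "[] \<in> carrier (free_group S)"
  by (simp add: carrier_free_group)

lemma foldr_push_in_free_group:
  "\<lbrakk>u \<in> carrier (free_group S); v \<in> carrier (free_group S)\<rbrakk> \<Longrightarrow> foldr push u v \<in> carrier (free_group S)"
  by (rule foldr_push_closed) (auto simp: carrier_free_group)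

text \<open>Spells the axioms out as conditions on the membership of single pairs, the form in which
  compactness recognises each of them as a closed condition.\<close>

lemma left_orderings_iff:
  "r \<in> left_orderings (free_group S) \<longleftrightarrow>
    r \<subseteq> carrier (free_group S) \<times> carrier (free_group S) \<and>
    (\<forall>g\<in>carrier (free_group S). (g, g) \<in> r) \<and>
    (\<forall>f g h. (f, g) \<in> r \<longrightarrow> (g, h) \<in> r \<longrightarrow> (f, h) \<in> r) \<and>
    (\<forall>g h. (g, h) \<in> r \<longrightarrow> (h, g) \<in> r \<longrightarrow> g = h) \<and>
    (\<forall>g\<in>carrier (free_group S). \<forall>h\<in>carrier (free_group S). (g, h) \<in> r \<or> (h, g) \<in> r) \<and>
    (\<forall>f\<in>carrier (free_group S). \<forall>g h. (g, h) \<in> r \<longrightarrow> (foldr push f g, foldr push f h) \<in> r)"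
proof -
  let ?F = "carrier (free_group S)"
  have "r \<subseteq> ?F \<times> ?F \<Longrightarrow> total_on ?F r \<and> refl_on ?F r \<longleftrightarrow>
      (\<forall>g\<in>?F. (g, g) \<in> r) \<and> (\<forall>g\<in>?F. \<forall>h\<in>?F. (g, h) \<in> r \<or> (h, g) \<in> r)"
    by (auto simp: total_on_def refl_on_def) metis
  moreover have "r \<subseteq> ?F \<times> ?F \<Longrightarrow>
      (\<forall>f\<in>?F. \<forall>g\<in>?F. \<forall>h\<in>?F. (g, h) \<in> r \<longrightarrow> (foldr push f g, foldr push f h) \<in> r) \<longleftrightarrow>
      (\<forall>f\<in>?F. \<forall>g h. (g, h) \<in> r \<longrightarrow> (foldr push f g, foldr push f h) \<in> r)"
    by blast
  moreover have "trans r \<longleftrightarrow> (\<forall>f g h. (f, g) \<in> r \<longrightarrow> (g, h) \<in> r \<longrightarrow> (f, h) \<in> r)"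
    by (auto simp: trans_def)
  moreover have "antisym r \<longleftrightarrow> (\<forall>g h. (g, h) \<in> r \<longrightarrow> (h, g) \<in> r \<longrightarrow> g = h)"
    by (auto simp: antisym_def)
  ultimately show ?thesis
    unfolding left_orderings_def linear_order_on_def partial_order_on_def preorder_on_def
      mult_free_group mem_Collect_eq
    by argo
qed

lemma left_orderingD:
  assumes "r \<in> left_orderings (free_group S)"
  shows left_ordering_closed: "(g, h) \<in> r \<Longrightarrow> g \<in> carrier (free_group S) \<and> h \<in> carrier (free_group S)"
    and left_ordering_refl: "g \<in> carrier (free_group S) \<Longrightarrow> (g, g) \<in> r"
    and left_ordering_trans: "\<lbrakk>(f, g) \<in> r; (g, h) \<in> r\<rbrakk> \<Longrightarrow> (f, h) \<in> r"
    and left_ordering_antisym: "\<lbrakk>(g, h) \<in> r; (h, g) \<in> r\<rbrakk> \<Longrightarrow> g = h"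
    and left_ordering_total: "\<lbrakk>g \<in> carrier (free_group S); h \<in> carrier (free_group S)\<rbrakk>
      \<Longrightarrow> (g, h) \<in> r \<or> (h, g) \<in> r"
    and left_ordering_left: "\<lbrakk>f \<in> carrier (free_group S); (g, h) \<in> r\<rbrakk>
      \<Longrightarrow> (foldr push f g, foldr push f h) \<in> r"
  using assms unfolding left_orderings_iff by blast+

text \<open>Increasing bijections preserve both the strict order of orbit points and ties. Ties
  occur when \<open>t\<close> has a nontrivial stabiliser, and there \<open>r\<close>
  decides.\<close>

lemma orbit_ordering:
  assumes r: "r \<in> left_orderings (free_group S)" and \<phi>: "line_action \<phi>"
  shows "{(g, h). g \<in> carrier (free_group S) \<and> h \<in> carrier (free_group S) \<and>
    (foldr \<phi> g t < foldr \<phi> h t \<or> foldr \<phi> g t = foldr \<phi> h t \<and> (g, h) \<in> r)}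
    \<in> left_orderings (free_group S)" (is "?r \<in> _")
proof -
  have mono: "foldr \<phi> f x < foldr \<phi> f y \<longleftrightarrow> x < y" "foldr \<phi> f x = foldr \<phi> f y \<longleftrightarrow> x = y" for f x y
    using strict_mono_foldr[OF \<phi>, of f] by (auto simp: strict_mono_less strict_mono_eq)
  show ?thesis
    unfolding left_orderings_iff
  proof (intro conjI allI ballI impI)
    fix g h assume "g \<in> carrier (free_group S)" "h \<in> carrier (free_group S)"
    then show "(g, h) \<in> ?r \<or> (h, g) \<in> ?r"
      using left_ordering_total[OF r, of g h] by (cases "foldr \<phi> g t" "foldr \<phi> h t" rule: linorder_cases) auto
  next
    fix f g h assume "(f, g) \<in> ?r" "(g, h) \<in> ?r"
    then show "(f, h) \<in> ?r" using left_ordering_trans[OF r, of f g h] by auto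
  next
    fix g h assume "(g, h) \<in> ?r" "(h, g) \<in> ?r"
    then show "g = h" using left_ordering_antisym[OF r, of g h] by auto
  qed (auto simp: foldr_push_line_action[OF \<phi>] mono foldr_push_in_free_group
      left_ordering_refl[OF r] left_ordering_left[OF r])
qed

text \<open>Letting a reduced word move the origin to the right at every letter is consistent, because
  no letter is followed by its inverse.\<close>

lemma reduced_word_acts_nontrivially:
  assumes "reduced_word w"
  shows "\<exists>\<phi>. line_action \<phi> \<and> foldr \<phi> w 0 = length w"
proof -
  \<comment> \<open>The suffixes of \<open>w\<close>, the path from the identity to \<open>w\<close>
    in the Cayley graph. A suffix is determined by its length, so length can serve as the position
    on the line.\<close>
  let ?B = "{u. \<exists>v. w = v @ u}"
  have suffix_eq: "u = v" if "u \<in> ?B" "v \<in> ?B" "length u = length v" for u v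
    using that by auto
  have red: "reduced_word u" if "u \<in> ?B" for u
    using that assms by (auto simp: reduced_word_def successively_append_iff)
  obtain \<phi> where \<phi>: "line_action \<phi>" "\<And>u. u \<in> ?B \<Longrightarrow> foldr \<phi> u (real (length ([]::'a letter list))) = real (length u)"
  proof (rule line_action_extension[of ?B "\<lambda>u. real (length u)"])
    have "u \<in> (\<lambda>k. drop k w) ` {..length w}" if "u \<in> ?B" for u
      using that by (auto intro!: image_eqI[of _ _ "length w - length u"])
    then have "?B \<subseteq> (\<lambda>k. drop k w) ` {..length w}" by blast
    then show "finite ?B" by (rule finite_subset) simp
    show "reduced_word u" if "u \<in> ?B" for u using red that by blast
    show "u \<in> ?B" if "x # u \<in> ?B" for x u
      using that by (auto intro: exI[of _ "_ @ [x]"])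
    show "inj_on (\<lambda>u. real (length u)) ?B" by (rule inj_onI, rule suffix_eq) auto
  next
    fix a :: 'a and u v
    let ?x = "(a, True)"
    assume *: "u \<in> ?B" "v \<in> ?B" "push ?x u \<in> ?B" "push ?x v \<in> ?B" "real (length u) < real (length v)"
    note push = push_cases[of ?x]
    show "real (length (push ?x u)) < real (length (push ?x v))"
    proof (rule ccontr)
      assume "\<not> ?thesis"
      then have le: "length (push ?x v) \<le> length (push ?x u)" by simp
      consider "push ?x u = ?x # u" "push ?x v = ?x # v" | "u = inv_letter ?x # push ?x u"
        | "push ?x u = ?x # u" "v = inv_letter ?x # push ?x v"
        using push by blast
      then show False
      proof cases
        case 1
        then show False using le *(5) by simp
      next
        case 2
        then have "length u = Suc (length (push ?x u))" by (metis length_Cons)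
        moreover have "length v \<le> Suc (length (push ?x v))" using push[of v] by (metis length_Cons le_Suc_eq order_refl)
        ultimately show False using le *(5) by simp
      next
        case 3
        have v: "length v = Suc (length (push ?x v))" using 3(2) by (metis length_Cons)
        have u: "length (push ?x u) = Suc (length u)" using 3(1) by simp
        \<comment> \<open>Here \<open>u\<close> gains a letter and \<open>v\<close> loses one, so
          their lengths differ by one or two. In the first case \<open>?x # u\<close> and
          \<open>v\<close> are the same suffix but begin with inverse letters; in the second
          \<open>v\<close> begins with a cancelling pair.\<close>
        consider "length (push ?x v) = length u" | "length (push ?x v) = Suc (length u)"
          using le *(5) u v by linarith
        then show False
        proof cases
          case 1
          then have "push ?x u = v" using u v suffix_eq[OF *(3) *(2)] by simp
          then show False using 3 by (metis inv_letter_neq(2) list.inject)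
        next
          case 2
          then have "push ?x v = push ?x u" using u suffix_eq[OF *(4) *(3)] by simp
          then have "v = inv_letter ?x # ?x # u" using 3 by simp
          then show False using red[OF *(2)] by (simp add: reduced_word_Cons)
        qed
      qed
    qed
  qed (use that in blast)
  have "foldr \<phi> w 0 = length w" using \<phi>(2)[of w] by simp
  with \<phi>(1) show ?thesis by blast
qed

text \<open>One action is taken for each word of an enumeration, and a group element is recorded by
  the sequence of images of 0. Lexicographic comparison is left-invariant because every action is
  increasing, and distinct elements have distinct sequences because a nontrivial word moves 0 in its
  own action.\<close>

lemma left_orderings_free_group_nonempty:
  fixes S :: "'a::countable set"
  shows "left_orderings (free_group S) \<noteq> {}"
proof -
  define W :: "nat \<Rightarrow> 'a letter list" where "W = from_nat"
  have "\<exists>\<phi>. line_action \<phi> \<and> (reduced_word (W i) \<longrightarrow> foldr \<phi> (W i) 0 = length (W i))" for i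
  proof (cases "reduced_word (W i)")
    case True
    then show ?thesis using reduced_word_acts_nontrivially[OF True] by simp
  next
    case False
    \<comment> \<open>For indices of unreduced words any action will do; the one for the empty word
      serves as default.\<close>
    then show ?thesis using reduced_word_acts_nontrivially[of "[] :: 'a letter list"] by auto
  qed
  then obtain \<Phi> where \<Phi>: "\<And>i. line_action (\<Phi> i)"
    "\<And>i. reduced_word (W i) \<Longrightarrow> foldr (\<Phi> i) (W i) 0 = length (W i)"
    by metis
  define orbit where "orbit w i = foldr (\<Phi> i) w 0" for w i
  have orbit_push: "orbit (foldr push u v) i = foldr (\<Phi> i) u (orbit v i)" for u v i
    using \<Phi> by (simp add: orbit_def foldr_push_line_action)
  have orbit_inj: "g = h"
    if g: "g \<in> carrier (free_group S)" and h: "h \<in> carrier (free_group S)" and eq: "orbit g = orbit h" for g h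
  proof -
    interpret group "free_group S" by (rule group_free_group)
    let ?k = "inv\<^bsub>free_group S\<^esub> g" 
    define w where "w = foldr push ?k h"
    have k: "?k \<in> carrier (free_group S)" using g by simp
    have "orbit w i = 0" for i
    proof -
      have "orbit w i = orbit (foldr push ?k g) i" by (simp add: w_def orbit_push eq)
      also have "foldr push ?k g = []"
        using l_inv[OF g] by (simp add: mult_free_group one_free_group)
      finally show ?thesis by (simp add: orbit_def)
    qed
    moreover have "reduced_word w"
      using foldr_push_in_free_group[OF k h] by (simp add: w_def carrier_free_group)
    \<comment> \<open>The action with index \<open>to_nat w\<close> moves 0 by the length of
      \<open>w\<close>, but \<open>w\<close> fixes 0 in every action.\<close>
    ultimately have "w = []" using \<Phi>(2)[of "to_nat w"] by (simp add: orbit_def W_def)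
    then have "?k \<otimes>\<^bsub>free_group S\<^esub> h = \<one>\<^bsub>free_group S\<^esub>"
      by (simp add: w_def mult_free_group one_free_group)
    then show "g = h" using g h k by (metis inv_equality inv_inv inv_comm)
  qed
  have total: "less_fun f g \<or> less_fun g f" if ne: "f \<noteq> g" for f g :: "nat \<Rightarrow> real"
  proof -
    have "\<exists>i. f i \<noteq> g i" using ne by auto
    then obtain i where i: "f i \<noteq> g i" "\<forall>j<i. f j = g j"
      using exists_least_iff[of "\<lambda>i. f i \<noteq> g i"] by auto
    then show ?thesis unfolding less_fun_def by (metis linorder_neqE_linordered_idom)
  qed
  have left: "less_fun (orbit (foldr push f g)) (orbit (foldr push f h))"
    if lt: "less_fun (orbit g) (orbit h)" for f g h
  proof -
    obtain k where k: "orbit g k < orbit h k" "\<And>j. j < k \<Longrightarrow> orbit g j = orbit h j"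
      using less_funE[OF lt] by blast
    then show ?thesis
      using strict_mono_foldr[OF \<Phi>(1)] unfolding less_fun_def orbit_push
      by (intro exI[of _ k]) (auto simp: strict_mono_less)
  qed
  have "{(g, h). g \<in> carrier (free_group S) \<and> h \<in> carrier (free_group S) \<and>
      (g = h \<or> less_fun (orbit g) (orbit h))} \<in> left_orderings (free_group S)" (is "?r \<in> _")
    unfolding left_orderings_iff
  proof (intro conjI allI ballI impI)
    fix g h assume "g \<in> carrier (free_group S)" "h \<in> carrier (free_group S)"
    then show "(g, h) \<in> ?r \<or> (h, g) \<in> ?r" using total[of "orbit g" "orbit h"] orbit_inj[of g h] by auto
  next
    fix f g h assume "(f, g) \<in> ?r" "(g, h) \<in> ?r"
    then show "(f, h) \<in> ?r" using less_fun_trans[of "orbit f" "orbit g" "orbit h"] by auto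
  next
    fix g h assume "(g, h) \<in> ?r" "(h, g) \<in> ?r"
    then show "g = h" using less_fun_asym[of "orbit g" "orbit h"] by auto
  qed (auto simp: foldr_push_in_free_group left)
  then show ?thesis by blast
qed

section \<open>The space of orderings of the free group\<close>

text \<open>Relations are points of a product of two-point spaces, compact by Tychonoff. Every
  instance of an ordering axiom involves finitely many coordinates, so the orderings form a closed
  set \<open>K\<close>, and \<open>Collect\<close> maps \<open>K\<close> continuously onto the space
  of orderings.\<close>

lemma compact_space_ordering_space:
  "compact_space (ordering_space (free_group S))"
proof -
  let ?LO = "left_orderings (free_group S)" and ?F = "carrier (free_group S)"
  define P where "P = product_topology (\<lambda>_. discrete_topology (UNIV :: bool set))
    (UNIV :: ('a letter list \<times> 'a letter list) set)"
  have top: "topspace P = UNIV" by (simp add: P_def)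
  have basic: "openin P {m. m p \<in> V}" for p V
  proof -
    have "continuous_map P (discrete_topology UNIV) (\<lambda>m. m p)"
      unfolding P_def by (rule continuous_map_product_projection) simp
    from openin_continuous_map_preimage[OF this, of V] show ?thesis by (simp add: top)
  qed
  have pos_open: "openin P {m. m p}" for p using basic[of p "{True}"] by simp
  have neg_open: "openin P {m. \<not> m p}" for p using basic[of p "{False}"] by simp
  have "UNIV - {m. m p} = {m. \<not> m p}" "UNIV - {m. \<not> m p} = {m. m p}" for p :: "'a letter list \<times> 'a letter list"
    by auto
  then have pos: "closedin P {m. m p}" and neg: "closedin P {m. \<not> m p}" for p
    unfolding closedin_def top using pos_open[of p] neg_open[of p] by simp_all
  have const: "closedin P {m. Q}" for Q using closedin_topspace[of P] by (cases Q) (simp_all add: top)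
  have all: "closedin P {m. \<forall>i. Q i m}" if "\<And>i. closedin P {m. Q i m}" for Q :: "'i \<Rightarrow> _ \<Rightarrow> bool"
    unfolding Collect_all_eq using that by (intro closedin_INT) auto
  have disj: "closedin P {m. Q m \<or> R m}" if "closedin P {m. Q m}" "closedin P {m. R m}" for Q R
    unfolding Collect_disj_eq using that by (rule closedin_Un)
  have conj: "closedin P {m. Q m \<and> R m}" if "closedin P {m. Q m}" "closedin P {m. R m}" for Q R
    unfolding Collect_conj_eq using that by (rule closedin_Int)
  define K where "K = {m. Collect m \<in> ?LO}"
  have "closedin P K"
    unfolding K_def left_orderings_iff subset_iff Ball_def imp_conv_disj mem_Collect_eq
    by (intro conj all disj const pos neg)
  moreover have "compact_space P"
    by (simp add: P_def compact_space_product_topology compact_space_discrete_topology)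
  ultimately have "compactin P K" by (rule closedin_compact_space[rotated])
  have top_K: "topspace (subtopology P K) = K" by (simp add: top)
  have "continuous_map (subtopology P K) (ordering_space (free_group S)) Collect"
    unfolding ordering_space_def
  proof (rule continuous_on_generated_topo)
    fix U assume "U \<in> insert ?LO {ordering_subbasic (free_group S) f g |f g. f \<in> ?F \<and> g \<in> ?F \<and> f \<noteq> g}"
    then consider "U = ?LO" | f g where "U = ordering_subbasic (free_group S) f g" "f \<noteq> g" by blast
    then show "openin (subtopology P K) (Collect -` U \<inter> topspace (subtopology P K))"
    proof cases
      case 1
      then have "Collect -` U \<inter> topspace (subtopology P K) = topspace (subtopology P K)"
        by (simp add: top K_def vimage_def)
      then show ?thesis by (simp only: openin_topspace)
    next
      case 2
      then have "Collect -` U \<inter> topspace (subtopology P K) = K \<inter> {m. m (f, g)}"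
        by (auto simp: top K_def ordering_subbasic_def)
      then show ?thesis using openin_subtopology_Int2[OF pos_open] by (simp only:)
    qed
  next
    show "Collect ` topspace (subtopology P K)
        \<subseteq> \<Union> (insert ?LO {ordering_subbasic (free_group S) f g |f g. f \<in> ?F \<and> g \<in> ?F \<and> f \<noteq> g})"
      unfolding top_K K_def by auto
  qed
  moreover have "compactin (subtopology P K) K"
    using \<open>compactin P K\<close> by (simp add: compactin_subtopology)
  ultimately have "compactin (ordering_space (free_group S)) (Collect ` K)"
    by (rule image_compactin[rotated])
  moreover have "Collect ` K = ?LO"
  proof
    show "?LO \<subseteq> Collect ` K"
    proof
      fix r assume "r \<in> ?LO"
      then have "(\<lambda>p. p \<in> r) \<in> K" by (simp add: K_def)
      then show "r \<in> Collect ` K" by (rule image_eqI[rotated]) simp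
    qed
    show "Collect ` K \<subseteq> ?LO" unfolding K_def by auto
  qed
  ultimately show ?thesis by (simp add: compact_space_def)
qed

text \<open>By totality and antisymmetry, the complement of one subbasic set is the subbasic set of
  the swapped pair. Pairs outside the group give the empty set, and diagonal pairs give the whole
  space.\<close>

lemma ordering_space_clopen:
  fixes S :: "'a set"
  defines "X \<equiv> ordering_space (free_group S)"
  shows "openin X {r \<in> left_orderings (free_group S). p \<in> r}"
    and "closedin X {r \<in> left_orderings (free_group S). p \<in> r}"
proof -
  let ?LO = "left_orderings (free_group S)" and ?F = "carrier (free_group S)"
  obtain f g where p: "p = (f, g)" by fastforce
  let ?C = "{r \<in> ?LO. p \<in> r}"
  have basic: "openin X (ordering_subbasic (free_group S) f g)" if "f \<in> ?F" "g \<in> ?F" "f \<noteq> g" for f g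
    unfolding X_def ordering_space_def using that by (intro topology_generated_by_Basis) blast
  have LO: "openin X ?LO" using openin_topspace[of X] by (simp add: X_def)
  have "openin X ?C \<and> openin X (?LO - ?C)"
  proof (cases "f \<in> ?F \<and> g \<in> ?F")
    case False
    then have "?C = {}" using left_ordering_closed p by blast
    then show ?thesis using LO by (simp only: Diff_empty openin_empty simp_thms)
  next
    case F: True
    show ?thesis
    proof (cases "f = g")
      case True
      then have "?C = ?LO" using F left_ordering_refl p by blast
      then show ?thesis using LO by (simp only: Diff_cancel openin_empty simp_thms)
    next
      case False
      then have "?C = ordering_subbasic (free_group S) f g" by (auto simp: ordering_subbasic_def p)
      moreover have "?LO - ?C = ordering_subbasic (free_group S) g f"
      proof
        show "?LO - ?C \<subseteq> ordering_subbasic (free_group S) g f"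
          using F False left_ordering_total unfolding ordering_subbasic_def p by blast
        show "ordering_subbasic (free_group S) g f \<subseteq> ?LO - ?C"
          using left_ordering_antisym unfolding ordering_subbasic_def p by blast
      qed
      ultimately show ?thesis using basic F False by simp
    qed
  qed
  then show "openin X ?C" "closedin X ?C" by (auto simp: closedin_def X_def)
qed

text \<open>A subbasic set constrains a single pair, and a finite intersection finitely many. For
  linear orders the inclusion on \<open>A\<close> already means agreement on
  \<open>A\<close>.\<close>

lemma ordering_space_neighbourhood:
  assumes "openin (ordering_space (free_group S)) U" "r \<in> U"
  shows "\<exists>A. finite A \<and> A \<subseteq> carrier (free_group S) \<and>
    (\<forall>r'\<in>left_orderings (free_group S). r \<inter> A \<times> A \<subseteq> r' \<longrightarrow> r' \<in> U)"
proof -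
  let ?B = "insert (left_orderings (free_group S)) {ordering_subbasic (free_group S) f g |f g.
    f \<in> carrier (free_group S) \<and> g \<in> carrier (free_group S) \<and> f \<noteq> g}"
  have "generate_topology_on ?B U"
    using assms(1) by (simp add: ordering_space_def openin_topology_generated_by_iff)
  then show ?thesis using assms(2)
  proof (induction U rule: generate_topology_on.induct)
    case (Int U V)
    obtain A where A: "finite A" "A \<subseteq> carrier (free_group S)"
      "\<And>r'. \<lbrakk>r' \<in> left_orderings (free_group S); r \<inter> A \<times> A \<subseteq> r'\<rbrakk> \<Longrightarrow> r' \<in> U"
      using Int.IH(1) Int.prems by blast
    obtain A' where A': "finite A'" "A' \<subseteq> carrier (free_group S)"
      "\<And>r'. \<lbrakk>r' \<in> left_orderings (free_group S); r \<inter> A' \<times> A' \<subseteq> r'\<rbrakk> \<Longrightarrow> r' \<in> V"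
      using Int.IH(2) Int.prems by blast
    show ?case
    proof (intro exI[of _ "A \<union> A'"] conjI ballI impI)
      fix r' assume r': "r' \<in> left_orderings (free_group S)" "r \<inter> (A \<union> A') \<times> (A \<union> A') \<subseteq> r'"
      then have "r \<inter> A \<times> A \<subseteq> r'" "r \<inter> A' \<times> A' \<subseteq> r'" by blast+
      then show "r' \<in> U \<inter> V" using A(3) A'(3) r'(1) by blast
    qed (use A A' in auto)
  next
    case (UN \<U>)
    from UN.prems obtain U where U: "U \<in> \<U>" "r \<in> U" by auto
    from UN.IH[OF U] obtain A where A: "finite A" "A \<subseteq> carrier (free_group S)"
      "\<And>r'. \<lbrakk>r' \<in> left_orderings (free_group S); r \<inter> A \<times> A \<subseteq> r'\<rbrakk> \<Longrightarrow> r' \<in> U"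
      by auto
    then show ?case using U(1) by (intro exI[of _ A]) auto
  next
    case (Basis U)
    from Basis.hyps consider "U = left_orderings (free_group S)"
      | f g where "U = ordering_subbasic (free_group S) f g" "f \<in> carrier (free_group S)"
        "g \<in> carrier (free_group S)" "f \<noteq> g"
      by auto
    then show ?case
    proof cases
      case 1
      then show ?thesis by (intro exI[of _ "{}"]) auto
    next
      case 2
      then show ?thesis using Basis.prems
        by (intro exI[of _ "{f, g}"]) (auto simp: ordering_subbasic_def)
    qed
  qed simp
qed

text \<open>The largest element \<open>w\<close> of the ball of radius \<open>N\<close> lies on its boundary, so some
  generator \<open>b\<close> has neither \<open>b w\<close> nor \<open>b\<^sup>-\<^sup>1 w\<close> in the ball. Hence the image of \<open>w\<close> under \<open>b\<close> may be
  placed on either side of \<open>w\<close>.\<close>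

lemma left_ordering_two_perturbations:
  fixes S :: "'a set"
  assumes r: "r \<in> left_orderings (free_group S)" and S: "finite S" "a0 \<in> S" "b0 \<in> S" "a0 \<noteq> b0"
    and A: "finite A" "A \<subseteq> carrier (free_group S)"
  obtains r1 r2 where "r1 \<in> left_orderings (free_group S)" "r2 \<in> left_orderings (free_group S)"
    "r \<inter> A \<times> A \<subseteq> r1" "r \<inter> A \<times> A \<subseteq> r2" "r1 \<noteq> r2"
proof -
  let ?F = "carrier (free_group S)"
  define N where "N = Max (insert 0 (length ` A))"
  define B where "B = {w \<in> ?F. length w \<le> N}"
  have AB: "A \<subseteq> B" using A by (auto simp: B_def N_def)
  have "B \<subseteq> {w. set w \<subseteq> S \<times> UNIV \<and> length w \<le> N}" by (force simp: B_def carrier_free_group)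
  then have finB: "finite B" using S(1) finite_lists_length_le[of "S \<times> (UNIV :: bool set)" N]
    by (auto intro: finite_subset)
  have NilB: "[] \<in> B" by (simp add: B_def)
  have BF: "w \<in> ?F" "reduced_word w" if "w \<in> B" for w
    using that by (auto simp: B_def carrier_free_group)
  note refl = left_ordering_refl[OF r]
    and trans = left_ordering_trans[OF r] and antisym = left_ordering_antisym[OF r]
    and total = left_ordering_total[OF r]
  have pushF: "push x u \<in> ?F" if "fst x \<in> S" "u \<in> ?F" for x u
    using foldr_push_in_free_group[of "[x]" S u] that by (simp add: carrier_free_group)
  have left: "(push x u, push x v) \<in> r" if "fst x \<in> S" "(u, v) \<in> r" for x u v
  proof -
    have "[x] \<in> ?F" using that by (simp add: carrier_free_group)
    then have "(foldr push [x] u, foldr push [x] v) \<in> r"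
      using that(2) by (rule left_ordering_left[OF r])
    then show ?thesis by simp
  qed
  \<comment> \<open>The rank within the ball embeds it in the natural numbers in an order-preserving
    way and leaves the half-integers free.\<close>
  define \<rho> where "\<rho> w = card {v \<in> B. (v, w) \<in> r}" for w
  have \<rho>_less: "\<rho> u < \<rho> v" if "(u, v) \<in> r" "u \<noteq> v" "v \<in> B" for u v
    unfolding \<rho>_def
  proof (rule psubset_card_mono)
    have "v \<in> {x \<in> B. (x, v) \<in> r}" "v \<notin> {x \<in> B. (x, u) \<in> r}"
      using that refl[OF BF(1)] antisym by auto
    moreover have "{x \<in> B. (x, u) \<in> r} \<subseteq> {x \<in> B. (x, v) \<in> r}" using that(1) trans by blast
    ultimately show "{x \<in> B. (x, u) \<in> r} \<subset> {x \<in> B. (x, v) \<in> r}" by blast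
  qed (use finB in simp)
  have \<rho>_iff: "\<rho> u < \<rho> v \<longleftrightarrow> (u, v) \<in> r \<and> u \<noteq> v" if "u \<in> B" "v \<in> B" for u v
    using \<rho>_less[OF _ _ that(2), of u] \<rho>_less[OF _ _ that(1), of v] total[OF BF(1)[OF that(1)] BF(1)[OF that(2)]]
    by (metis less_asym less_irrefl)
  have "Max (\<rho> ` B) \<in> \<rho> ` B" using finB NilB by (intro Max_in) auto
  then obtain w where w: "w \<in> B" and "\<rho> w = Max (\<rho> ` B)" by auto
  then have max: "\<rho> v \<le> \<rho> w" if "v \<in> B" for v using finB that by simp
  have max': "(v, w) \<in> r" if "v \<in> B" for v
    using max[OF that] \<rho>_iff[OF w that] total[OF BF(1)[OF that] BF(1)[OF w]] refl[OF BF(1)[OF w]]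
    by (metis leD)
  \<comment> \<open>Were \<open>w\<close> shorter, its products with \<open>a0\<close> and its
    inverse would both lie in the ball, hence below \<open>w\<close>. Multiplying the first
    inequality by the inverse of \<open>a0\<close> puts \<open>w\<close> below the second product,
    so the two coincide, which their lengths forbid.\<close>
  have len_w: "length w = N"
  proof (rule ccontr)
    assume "length w \<noteq> N"
    then have "length w < N" using w by (simp add: B_def)
    then have in_B: "push (a0, s) w \<in> B" for s
      using pushF[of "(a0, s)" w] w S length_push_le[of "(a0, s)" w] by (simp add: B_def)
    have "(push (a0, False) (push (a0, True) w), push (a0, False) w) \<in> r"
      using left[of "(a0, False)"] max'[OF in_B] S by simp
    then have "(w, push (a0, False) w) \<in> r"
      using push_inv_push[OF BF(2)[OF w], of "(a0, True)"] by (simp add: inv_letter_def)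
    then have "push (a0, False) w = w" using max'[OF in_B] antisym by blast
    then show False using length_push_neq[of "(a0, False)" w] by simp
  qed
  \<comment> \<open>Of two generators, at least one differs from that of the first letter of
    \<open>w\<close>; neither it nor its inverse cancels.\<close>
  obtain b where b: "b \<in> S" "w = [] \<or> fst (hd w) \<noteq> b" using S by blast
  define x where "x = (b, True)"
  have xw: "reduced_word (x # w)" "reduced_word (inv_letter x # w)"
    using b(2) BF(2)[OF w] by (auto simp: reduced_word_Cons x_def inv_letter_def)
  have xwF: "x # w \<in> ?F" using b xw BF(1)[OF w] by (simp add: carrier_free_group x_def)
  have notB: "x # w \<notin> B" using len_w by (simp add: B_def)
  \<comment> \<open>The new point \<open>x # w\<close> receives the position \<open>c\<close>, half
    a unit above or below the rank of \<open>w\<close>. Both values avoid all ranks and lie above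
    the ranks of the other elements of the ball.\<close>
  have "\<exists>r'\<in>left_orderings (free_group S). r \<inter> A \<times> A \<subseteq> r' \<and> ((x # w, w) \<in> r' \<longleftrightarrow> c < \<rho> w)"
    if c: "c = \<rho> w + 1 / 2 \<or> c = \<rho> w - 1 / 2" for c :: real
  proof -
    define e where "e u = (if u = x # w then c else real (\<rho> u))" for u
    have eB: "e u = \<rho> u" if "u \<in> B" for u using that notB by (auto simp: e_def)
    have exw: "e (x # w) = c" by (simp add: e_def)
    have c_neq: "c \<noteq> real k" for k :: nat
    proof
      assume "c = real k"
      then have "2 * real k = 2 * real (\<rho> w) + 1 \<or> 2 * real k + 1 = 2 * real (\<rho> w)" using c by auto
      then have "2 * k = 2 * \<rho> w + 1 \<or> 2 * k + 1 = 2 * \<rho> w" by linarith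
      then show False by presburger
    qed
    have below_c: "\<rho> v < c" if "v \<in> B" "v \<noteq> w" for v
    proof -
      have "\<rho> v < \<rho> w" using \<rho>_less[OF max'[OF that(1)] that(2) w] .
      then have "real (\<rho> v) + 1 \<le> \<rho> w" by linarith
      then show ?thesis using c by auto
    qed
    obtain \<phi> where \<phi>: "line_action \<phi>" "\<And>u. u \<in> insert (x # w) B \<Longrightarrow> foldr \<phi> u (e []) = e u"
    proof (rule line_action_extension[of "insert (x # w) B" e])
      show "finite (insert (x # w) B)" using finB by simp
      show "reduced_word u" if "u \<in> insert (x # w) B" for u using that xw BF by auto
      show "u \<in> insert (x # w) B" if "y # u \<in> insert (x # w) B" for y u
        using that w by (auto simp: B_def carrier_free_group reduced_word_Cons)
      have "inj_on e B"
      proof (rule inj_onI)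
        fix u v assume "u \<in> B" "v \<in> B" "e u = e v"
        then show "u = v"
          using \<rho>_iff[of u v] \<rho>_iff[of v u] total[of u v] BF(1)[of u] BF(1)[of v] by (auto simp: eB)
      qed
      moreover have "e (x # w) \<notin> e ` (B - {x # w})"
        using c_neq by (auto simp: exw eB)
      ultimately show "inj_on e (insert (x # w) B)" by (simp only: inj_on_insert simp_thms)
    next
      fix a :: 'a and u v
      let ?y = "(a, True)"
      assume *: "u \<in> insert (x # w) B" "v \<in> insert (x # w) B"
        "push ?y u \<in> insert (x # w) B" "push ?y v \<in> insert (x # w) B" "e u < e v"
      \<comment> \<open>No positive letter cancels \<open>x\<close>, so \<open>x # w\<close> is
        never an argument of the partial maps, only a value.\<close>
      have "z \<in> B" if "z \<in> insert (x # w) B" "push ?y z \<in> insert (x # w) B" for z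
        using that len_w by (auto simp: B_def x_def inv_letter_def)
      then have u: "u \<in> B" and v: "v \<in> B" using * by auto
      have eq_xw: "?y = x \<and> z = w" if "z \<in> B" "push ?y z = x # w" for z
      proof -
        have "z \<noteq> inv_letter ?y # x # w" using that len_w by (auto simp: B_def)
        then show ?thesis using push_cases[of ?y z] that(2) by auto
      qed
      have "\<rho> u < \<rho> v" using *(5) u v eB by simp
      then have uv: "(u, v) \<in> r" "u \<noteq> v" using \<rho>_iff u v by auto
      show "e (push ?y u) < e (push ?y v)"
      \<comment> \<open>Only \<open>w\<close>, the top of the ball, is sent to \<open>x # w\<close>.
        In that case the image of \<open>u\<close> lies in the ball and is not \<open>w\<close>,
        because \<open>inv_letter x # w\<close> is too long; so it stays below \<open>c\<close> for
        either choice. Otherwise left-invariance of \<open>r\<close> applies.\<close>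
      proof (cases "push ?y v = x # w")
        case True
        then have y: "?y = x" and "v = w" using eq_xw v by blast+
        then have "u \<noteq> w" using uv by simp
        then have "push ?y u \<in> B" using *(3) eq_xw[OF u] by auto
        moreover have "push ?y u \<noteq> w"
        proof
          assume "push ?y u = w"
          then have "u = push (inv_letter x) w" using push_inv_push[OF BF(2)[OF u], of x] y by simp
          then have "u = inv_letter x # w" using push_reduced[OF xw(2)] by simp
          then show False using u len_w by (simp add: B_def)
        qed
        ultimately show ?thesis using below_c True eB exw by simp
      next
        case False
        then have v': "push ?y v \<in> B" using *(4) by simp
        have "push ?y u \<noteq> x # w"
        proof
          assume "push ?y u = x # w"
          then have "u = w" using eq_xw u by blast
          then show False using max[OF v] \<open>\<rho> u < \<rho> v\<close> by simp
        qed
        then have u': "push ?y u \<in> B" using *(3) by simp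
        have "\<rho> (push ?y u) < \<rho> (push ?y v)"
        proof (rule \<rho>_less[OF left[OF _ uv(1)] _ v'])
          \<comment> \<open>The generator or its inverse occurs in \<open>u\<close> or in its image,
            both words over \<open>S\<close>; hence \<open>a\<close> belongs to
            \<open>S\<close>.\<close>
          have "\<exists>z\<in>{u, push ?y u}. ?y \<in> set z \<or> inv_letter ?y \<in> set z"
            using push_cases[of ?y u] by (metis insertCI list.set_intros(1))
          moreover have "fst ` set z \<subseteq> S" if "z \<in> {u, push ?y u}" for z
            using that BF(1)[OF u] BF(1)[OF u'] by (auto simp: carrier_free_group)
          ultimately show "fst ?y \<in> S" by (metis fst_inv_letter image_subset_iff)
          show "push ?y u \<noteq> push ?y v"
            using push_inv_push[OF BF(2)[OF u], of ?y] push_inv_push[OF BF(2)[OF v], of ?y] uv(2) by metis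
        qed
        then show ?thesis using eB u' v' by simp
      qed
    qed (use that in blast)
    define r' where "r' = {(g, h). g \<in> ?F \<and> h \<in> ?F \<and>
      (foldr \<phi> g (e []) < foldr \<phi> h (e []) \<or> foldr \<phi> g (e []) = foldr \<phi> h (e []) \<and> (g, h) \<in> r)}"
    have "r' \<in> left_orderings (free_group S)"
      unfolding r'_def by (rule orbit_ordering[OF r \<phi>(1)])
    moreover have "r \<inter> A \<times> A \<subseteq> r'"
    proof
      fix p assume "p \<in> r \<inter> A \<times> A"
      then obtain g h where p: "p = (g, h)" "(g, h) \<in> r" "g \<in> B" "h \<in> B" using AB by blast
      then have "g = h \<or> \<rho> g < \<rho> h" using \<rho>_iff by blast
      then show "p \<in> r'" using p BF \<phi>(2) eB by (auto simp: r'_def)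
    qed
    moreover have "(x # w, w) \<in> r' \<longleftrightarrow> c < \<rho> w"
    proof -
      have "foldr \<phi> (x # w) (e []) = c" "foldr \<phi> w (e []) = \<rho> w"
        using \<phi>(2)[of "x # w"] \<phi>(2)[of w] w eB exw by simp_all
      then show ?thesis using xwF BF(1)[OF w] c_neq[of "\<rho> w"] by (simp only: r'_def mem_Collect_eq prod.case) simp
    qed
    ultimately show ?thesis by blast
  qed
  note perturb = this
  obtain r1 where r1: "r1 \<in> left_orderings (free_group S)" "r \<inter> A \<times> A \<subseteq> r1" "(x # w, w) \<notin> r1"
    using perturb[of "\<rho> w + 1 / 2"] by auto
  obtain r2 where r2: "r2 \<in> left_orderings (free_group S)" "r \<inter> A \<times> A \<subseteq> r2" "(x # w, w) \<in> r2"
    using perturb[of "\<rho> w - 1 / 2"] by auto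
  show ?thesis using that[of r1 r2] r1 r2 by blast
qed

theorem theoremA:
  fixes n :: nat
  assumes "n \<ge> 2"
  shows "ordering_space (free_group {..<n}) homeomorphic_space top_of_set cantor_set"
proof (rule homeomorphic_cantor_set)
  let ?X = "ordering_space (free_group {..<n})" and ?LO = "left_orderings (free_group {..<n})"
  \<comment> \<open>\<open>from_nat\<close> enumerates all pairs of words, and an ordering is
    determined by the pairs it contains.\<close>
  let ?C = "\<lambda>k. {r \<in> ?LO. from_nat k \<in> r}"
  show "compact_space ?X" by (rule compact_space_ordering_space)
  show "topspace ?X \<noteq> {}" using left_orderings_free_group_nonempty[of "{..<n}"] by simp
  show "openin ?X (?C k)" "closedin ?X (?C k)" for k by (rule ordering_space_clopen)+
  show "r = r'" if "r \<in> topspace ?X" "r' \<in> topspace ?X" "\<And>k. r \<in> ?C k \<longleftrightarrow> r' \<in> ?C k" for r r'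
  proof (rule Set.set_eqI)
    show "p \<in> r \<longleftrightarrow> p \<in> r'" for p using that(1,2) that(3)[of "to_nat p"] by simp
  qed
  show "\<not> openin ?X {r}" for r
  proof
    assume op: "openin ?X {r}"
    then have r: "r \<in> ?LO" using openin_subset by fastforce
    obtain A where A: "finite A" "A \<subseteq> carrier (free_group {..<n})"
      "\<forall>r'\<in>?LO. r \<inter> A \<times> A \<subseteq> r' \<longrightarrow> r' \<in> {r}"
      using ordering_space_neighbourhood[OF op singletonI] by auto
    \<comment> \<open>Two distinct orderings agreeing with \<open>r\<close> on \<open>A\<close>
      suffice: they cannot both equal \<open>r\<close>.\<close>
    obtain r1 r2 where "r1 \<in> ?LO" "r2 \<in> ?LO" "r \<inter> A \<times> A \<subseteq> r1" "r \<inter> A \<times> A \<subseteq> r2" "r1 \<noteq> r2"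
      using left_ordering_two_perturbations[OF r, of 0 1 A] assms A(1,2) by auto
    then show False using A(3) by blast
  qed
qed

end
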